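(* Fix any $X\in\mathbb{R}^{n\times p}$ and $\lambda>0$. For almost every $y\in\mathbb{R}^n$ (with respect to Lebesgue measure), if the lasso solution at $y,X,\lambda$ is unique, then $\mathrm{null}(X_{\mathcal{E}})=\{0\}$, where $\mathcal{E}$ is the equicorrelation set at $y,X,\lambda$.
   Context: A lasso solution at $y,X,\lambda$ is a minimizer of $\frac12\|y-X\beta\|_2^2+\lambda\|\beta\|_1$ over $\beta\in\mathbb{R}^p$. All lasso solutions at $y,X,\lambda$ have the same fitted value $X\hat\beta$, and the equicorrelation set is $\mathcal{E}=\{i\in\{1,\dots,p\}: |X_i^T(y-X\hat\beta)|=\lambda\}$ for any lasso solution $\hat\beta$, where $X_i$ is the $i$th column of $X$. $X_{\mathcal{E}}$ is the submatrix of columns of $X$ with index in $\mathcal{E}$, and $\mathrm{null}$ denotes the null space. *)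

theory Defs
  imports "HOL-Analysis.Analysis"
begin

definition lasso_objective ::
  "real^'n \<Rightarrow> real^'p^'n \<Rightarrow> real \<Rightarrow> real^'p \<Rightarrow> real" where
  "lasso_objective y X lam b =
     1/2 * (norm (y - X *v b))\<^sup>2 + lam * (\<Sum>i\<in>UNIV. \<bar>b $ i\<bar>)"

definition lasso_solution ::
  "real^'n \<Rightarrow> real^'p^'n \<Rightarrow> real \<Rightarrow> real^'p \<Rightarrow> bool" where
  "lasso_solution y X lam b \<longleftrightarrow> is_arg_min (lasso_objective y X lam) (\<lambda>_. True) b"

(* The choice of b is irrelevant, see lasso_fit_unique and equicorrelation_set_eq below. *)
definition equicorrelation_set ::
  "real^'n \<Rightarrow> real^'p^'n \<Rightarrow> real \<Rightarrow> 'p set" where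
  "equicorrelation_set y X lam =
     {i. \<exists>b. lasso_solution y X lam b \<and> \<bar>column i X \<bullet> (y - X *v b)\<bar> = lam}"

(* The null space of the submatrix of X with columns indexed by E. As E is not a type, a
   coefficient vector in R^E is represented by the vector in R^p that extends it by zero. *)
definition null_submatrix :: "real^'p^'n \<Rightarrow> 'p set \<Rightarrow> (real^'p) set" where
  "null_submatrix X E =
     {c. (\<forall>i. i \<notin> E \<longrightarrow> c $ i = 0) \<and> (\<Sum>i\<in>E. c $ i *\<^sub>R column i X) = 0}"

lemma lasso_fit_unique:
  fixes X :: "real^'p^'n"
  assumes "0 \<le> lam" and a: "lasso_solution y X lam a" and b: "lasso_solution y X lam b"
  shows "X *v a = X *v b"
proof -
  let ?f = "lasso_objective y X lam"
  let ?m = "(1/2) *\<^sub>R (a + b)"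
  let ?u = "y - X *v a" and ?v = "y - X *v b"
  have le: "?f a \<le> ?f z" "?f b \<le> ?f z" for z
    using a b by (auto simp: lasso_solution_def is_arg_min_def not_less)
  have m: "y - X *v ?m = (1/2) *\<^sub>R (?u + ?v)"
  proof -
    have "X *v ?m = (1/2) *\<^sub>R (X *v a + X *v b)"
      by (simp only: matrix_vector_mult_scaleR matrix_vector_right_distrib)
    then show ?thesis by (simp add: algebra_simps flip: scaleR_2)
  qed
  have half_sum: "(norm ((1/2) *\<^sub>R (u + v)))\<^sup>2
      = 1/2 * (norm u)\<^sup>2 + 1/2 * (norm v)\<^sup>2 - 1/4 * (norm (u - v))\<^sup>2" for u v :: "real^'n"
    unfolding power2_norm_eq_inner inner_scaleR_left inner_scaleR_right
      inner_add_left inner_add_right inner_diff_left inner_diff_right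
    by (simp add: inner_commute[of v u] field_simps)
  have "(\<Sum>i\<in>UNIV. \<bar>?m $ i\<bar>) \<le> (\<Sum>i\<in>UNIV. 1/2 * (\<bar>a $ i\<bar> + \<bar>b $ i\<bar>))"
    by (intro sum_mono) (simp add: abs_mult)
  also have "\<dots> = 1/2 * ((\<Sum>i\<in>UNIV. \<bar>a $ i\<bar>) + (\<Sum>i\<in>UNIV. \<bar>b $ i\<bar>))"
    by (simp only: sum_distrib_left[symmetric] sum.distrib)
  finally have "lam * (\<Sum>i\<in>UNIV. \<bar>?m $ i\<bar>)
      \<le> lam * (1/2 * ((\<Sum>i\<in>UNIV. \<bar>a $ i\<bar>) + (\<Sum>i\<in>UNIV. \<bar>b $ i\<bar>)))"
    using \<open>0 \<le> lam\<close> by (rule mult_left_mono)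
  moreover have "(norm (y - X *v ?m))\<^sup>2
      = 1/2 * (norm ?u)\<^sup>2 + 1/2 * (norm ?v)\<^sup>2 - 1/4 * (norm (?u - ?v))\<^sup>2"
    unfolding m by (rule half_sum)
  ultimately have "?f ?m \<le> 1/2 * ?f a + 1/2 * ?f b - 1/8 * (norm (?u - ?v))\<^sup>2"
    unfolding lasso_objective_def by (simp add: algebra_simps)
  with le[of ?m] have "(norm (?u - ?v))\<^sup>2 \<le> 0" by linarith
  then show ?thesis by simp
qed

lemma equicorrelation_set_eq:
  assumes "0 \<le> lam" and "lasso_solution y X lam b"
  shows "equicorrelation_set y X lam = {i. \<bar>column i X \<bullet> (y - X *v b)\<bar> = lam}"
  using assms lasso_fit_unique unfolding equicorrelation_set_def by fastforce

end

theory Submission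
  imports Defs
begin

text \<open>
  Let \<open>b\<close> be the unique lasso solution at \<open>y\<close>, let \<open>r = y - X b\<close>, let \<open>A\<close> be the support of \<open>b\<close> and
  \<open>E\<close> the equicorrelation set. Stationarity gives \<open>X\<^sub>i \<bullet> r = lam * sgn b\<^sub>i\<close> for \<open>i \<in> A\<close>, so \<open>A \<subseteq> E\<close>.

  Two mechanisms are played against each other. A direction \<open>c\<close> with \<open>X c = 0\<close> that is supported in
  \<open>E\<close> and points into the orthant given by the signs of \<open>X\<^sub>i \<bullet> r\<close> wherever \<open>b\<close> vanishes can be
  followed for a short time without changing the objective: the fit is constant, and the \<open>l1\<close> norm
  changes by a multiple of \<open>r \<bullet> X c = 0\<close> (\<open>lasso_solution_move_along_null_direction\<close>). If the
  solution is unique, every such \<open>c\<close> is therefore zero. When \<open>E = A\<close> there is no sign condition left,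
  and this says exactly that \<open>null (X\<^sub>E) = {0}\<close>.

  It remains to exclude \<open>A \<subset> E\<close> for almost all \<open>y\<close>. Given \<open>i \<in> E - A\<close>, project \<open>X\<^sub>i\<close> orthogonally to the
  span of \<open>X\<^sub>j\<close>, \<open>j \<in> A\<close>, and write the result as \<open>X c\<close> with \<open>c\<^sub>i = 1\<close> and \<open>c\<close> supported in \<open>A\<close> and
  \<open>i\<close>. If \<open>X c = 0\<close>, then \<open>c\<close> or \<open>-c\<close> is a forbidden direction. If \<open>X c \<noteq> 0\<close>, then
  \<open>X c \<bullet> y = X c \<bullet> r = lam * (\<Sum>j. c\<^sub>j s\<^sub>j)\<close> with signs \<open>s\<^sub>j\<close>, since \<open>X c\<close> is orthogonal to \<open>X b\<close>. So \<open>y\<close>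
  lies on a hyperplane determined by \<open>A\<close>, \<open>i\<close> and \<open>s\<close>, and there are only finitely many of those.
\<close>

lemma matrix_vector_mult_inner_columns:
  fixes X :: "real^'p^'n"
  shows "(X *v c) \<bullet> r = (\<Sum>j\<in>UNIV. c $ j * (column j X \<bullet> r))"
  by (simp add: matrix_mult_sum inner_sum_left scalar_mult_eq_scaleR)

lemma null_submatrix_iff:
  fixes X :: "real^'p^'n"
  shows "c \<in> null_submatrix X E \<longleftrightarrow> (\<forall>i. i \<notin> E \<longrightarrow> c $ i = 0) \<and> X *v c = 0"
proof -
  have "X *v c = (\<Sum>i\<in>E. c $ i *\<^sub>R column i X)" if "\<forall>i. i \<notin> E \<longrightarrow> c $ i = 0"
    unfolding matrix_mult_sum scalar_mult_eq_scaleR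
    using that by (intro sum.mono_neutral_right) auto
  then show ?thesis by (auto simp: null_submatrix_def)
qed

lemma abs_add_small:
  fixes b d :: real
  assumes "\<bar>d\<bar> < \<bar>b\<bar>"
  shows "\<bar>b + d\<bar> = \<bar>b\<bar> + d * sgn b"
  using assms by (auto simp: abs_if sgn_if split: if_splits)

text \<open>
  Along the coordinate axis \<open>i\<close> the objective is a quadratic polynomial near a solution with
  \<open>b $ i \<noteq> 0\<close>, so its linear coefficient vanishes there.
\<close>

lemma column_inner_residual_on_support:
  fixes X :: "real^'p^'n"
  assumes sol: "lasso_solution y X lam b" and nz: "b $ i \<noteq> 0"
  shows "column i X \<bullet> (y - X *v b) = lam * sgn (b $ i)"
proof -
  let ?f = "lasso_objective y X lam"
  let ?r = "y - X *v b" and ?x = "column i X"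
  define q where "q t = - t * (?x \<bullet> ?r) + t\<^sup>2 / 2 * (?x \<bullet> ?x) + lam * (t * sgn (b $ i))" for t
  have nonneg: "0 \<le> q t" if t: "\<bar>t\<bar> < \<bar>b $ i\<bar>" for t
  proof -
    let ?b = "b + t *\<^sub>R axis i 1"
    have "y - X *v ?b = ?r - t *\<^sub>R ?x"
      by (simp add: matrix_vector_right_distrib matrix_vector_mult_scaleR
          matrix_vector_mult_basis algebra_simps)
    moreover have "(norm (?r - t *\<^sub>R ?x))\<^sup>2
        = (norm ?r)\<^sup>2 - 2 * t * (?x \<bullet> ?r) + t\<^sup>2 * (?x \<bullet> ?x)"
      unfolding power2_norm_eq_inner
      by (simp add: inner_diff_left inner_diff_right inner_commute power2_eq_square algebra_simps)
    ultimately have fit: "(norm (y - X *v ?b))\<^sup>2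
        = (norm ?r)\<^sup>2 - 2 * t * (?x \<bullet> ?r) + t\<^sup>2 * (?x \<bullet> ?x)"
      by (simp only:)
    have "(\<Sum>j\<in>UNIV. \<bar>?b $ j\<bar>) = (\<Sum>j\<in>UNIV. \<bar>b $ j\<bar> + (if j = i then t * sgn (b $ i) else 0))"
      using abs_add_small[OF t] by (intro sum.cong) (auto simp: axis_def)
    then have l1: "(\<Sum>j\<in>UNIV. \<bar>?b $ j\<bar>) = (\<Sum>j\<in>UNIV. \<bar>b $ j\<bar>) + t * sgn (b $ i)"
      by (simp add: sum.distrib)
    have "?f b \<le> ?f ?b"
      using sol by (auto simp: lasso_solution_def is_arg_min_def not_less)
    then show ?thesis
      unfolding lasso_objective_def fit l1 q_def by (simp add: algebra_simps)
  qed
  have "(q has_real_derivative lam * sgn (b $ i) - ?x \<bullet> ?r) (at 0)"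
    unfolding q_def by (auto intro!: derivative_eq_intros)
  then have "lam * sgn (b $ i) - ?x \<bullet> ?r = 0"
    by (rule DERIV_local_min[where d = "\<bar>b $ i\<bar>"]) (use nz nonneg in \<open>auto simp: q_def\<close>)
  then show ?thesis by simp
qed

text \<open>
  On the support of \<open>b\<close>, and in the directions allowed by \<open>sign\<close> off the support, the absolute value
  is affine with slope \<open>X\<^sub>i \<bullet> r / lam\<close> near \<open>b $ i\<close>. Hence the \<open>l1\<close> norm is affine along \<open>c\<close> with slope
  \<open>X c \<bullet> r / lam = 0\<close>, and the objective keeps its minimal value.
\<close>

lemma lasso_solution_move_along_null_direction:
  fixes X :: "real^'p^'n"
  assumes lam: "0 < lam" and sol: "lasso_solution y X lam b" and null: "X *v c = 0"
    and equi: "\<And>i. c $ i \<noteq> 0 \<Longrightarrow> \<bar>column i X \<bullet> (y - X *v b)\<bar> = lam"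
    and sign: "\<And>i. b $ i = 0 \<Longrightarrow> 0 \<le> c $ i * (column i X \<bullet> (y - X *v b))"
  obtains t where "0 < t" "lasso_solution y X lam (b + t *\<^sub>R c)"
proof -
  let ?r = "y - X *v b"
  let ?slope = "\<lambda>i. c $ i * (column i X \<bullet> ?r) / lam"
  have "\<forall>\<^sub>F t in at_right 0. \<bar>b $ i + t * c $ i\<bar> = \<bar>b $ i\<bar> + t * ?slope i" for i
  proof (cases "b $ i = 0")
    case True
    have "\<bar>c $ i\<bar> * lam = \<bar>c $ i * (column i X \<bullet> ?r)\<bar>"
      using equi[of i] by (cases "c $ i = 0") (auto simp: abs_mult)
    also have "\<dots> = c $ i * (column i X \<bullet> ?r)"
      using sign[OF True] by simp
    finally have "\<bar>c $ i\<bar> = ?slope i"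
      using lam by (simp add: field_simps)
    then have "\<bar>b $ i + t * c $ i\<bar> = \<bar>b $ i\<bar> + t * ?slope i" if "0 < t" for t
      using True that by (simp add: abs_mult)
    then show ?thesis
      by (intro eventually_at_right_less[THEN eventually_mono])
  next
    case False
    have slope: "?slope i = c $ i * sgn (b $ i)"
      using column_inner_residual_on_support[OF sol False] lam by simp
    have "((\<lambda>t. \<bar>t * c $ i\<bar>) \<longlongrightarrow> \<bar>0 * c $ i\<bar>) (at_right 0)"
      by (intro tendsto_intros)
    then have "\<forall>\<^sub>F t in at_right 0. \<bar>t * c $ i\<bar> < \<bar>b $ i\<bar>"
      by (rule order_tendstoD) (use False in simp)
    then show ?thesis
      by (rule eventually_mono) (simp add: slope abs_add_small)
  qed
  then have "\<forall>\<^sub>F t in at_right 0. \<forall>i. \<bar>b $ i + t * c $ i\<bar> = \<bar>b $ i\<bar> + t * ?slope i"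
    by (rule eventually_all_finite)
  then have "\<forall>\<^sub>F t in at_right 0. 0 < t \<and> (\<forall>i. \<bar>b $ i + t * c $ i\<bar> = \<bar>b $ i\<bar> + t * ?slope i)"
    by (rule eventually_conj[OF eventually_at_right_less])
  then obtain t where t: "0 < t"
    and abs: "\<And>i. \<bar>b $ i + t * c $ i\<bar> = \<bar>b $ i\<bar> + t * ?slope i"
    using eventually_happens'[OF trivial_limit_at_right_real] by blast
  have "(\<Sum>i\<in>UNIV. ?slope i) = (X *v c) \<bullet> ?r / lam"
    by (simp add: matrix_vector_mult_inner_columns sum_divide_distrib)
  then have slope0: "(\<Sum>i\<in>UNIV. ?slope i) = 0"
    using null by simp
  have "(\<Sum>i\<in>UNIV. \<bar>(b + t *\<^sub>R c) $ i\<bar>) = (\<Sum>i\<in>UNIV. \<bar>b $ i\<bar>) + t * (\<Sum>i\<in>UNIV. ?slope i)"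
    by (simp only: vector_add_component vector_scaleR_component real_scaleR_def abs
        sum.distrib sum_distrib_left)
  moreover have "X *v (b + t *\<^sub>R c) = X *v b"
    using null by (simp add: matrix_vector_right_distrib matrix_vector_mult_scaleR)
  ultimately have "lasso_objective y X lam (b + t *\<^sub>R c) = lasso_objective y X lam b"
    by (simp only: lasso_objective_def slope0 mult_zero_right add_0_right)
  then have "lasso_solution y X lam (b + t *\<^sub>R c)"
    using sol by (simp add: lasso_solution_def is_arg_min_def)
  with t show ?thesis by (rule that)
qed

corollary unique_lasso_null_direction_eq_0:
  fixes X :: "real^'p^'n"
  assumes "0 < lam" and sol: "lasso_solution y X lam b"
    and unique: "\<And>b'. lasso_solution y X lam b' \<Longrightarrow> b' = b"
    and "X *v c = 0"
    and "\<And>i. c $ i \<noteq> 0 \<Longrightarrow> \<bar>column i X \<bullet> (y - X *v b)\<bar> = lam"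
    and "\<And>i. b $ i = 0 \<Longrightarrow> 0 \<le> c $ i * (column i X \<bullet> (y - X *v b))"
  shows "c = 0"
proof -
  obtain t where "0 < t" "lasso_solution y X lam (b + t *\<^sub>R c)"
    using lasso_solution_move_along_null_direction assms by blast
  with unique[of "b + t *\<^sub>R c"] show ?thesis by simp
qed

lemma span_columns_obtain_coefficients:
  fixes X :: "real^'p^'n"
  assumes "u \<in> span ((\<lambda>j. column j X) ` A)"
  obtains d where "\<And>j. j \<notin> A \<Longrightarrow> d $ j = 0" "X *v d = u"
proof -
  let ?D = "{d :: real^'p. \<forall>j. j \<notin> A \<longrightarrow> d $ j = 0}"
  have "subspace ?D"
    by (auto simp: subspace_def)
  then have "subspace ((*v) X ` ?D)"
    by (intro linear_subspace_image matrix_vector_mul_linear)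
  moreover have "(\<lambda>j. column j X) ` A \<subseteq> (*v) X ` ?D"
  proof clarify
    fix j assume "j \<in> A"
    then have "axis j 1 \<in> ?D" by (auto simp: axis_def)
    then have "X *v axis j 1 \<in> (*v) X ` ?D" by (rule imageI)
    then show "column j X \<in> (*v) X ` ?D" by (simp add: matrix_vector_mult_basis)
  qed
  ultimately have "span ((\<lambda>j. column j X) ` A) \<subseteq> (*v) X ` ?D"
    by (intro span_minimal)
  with assms that show ?thesis by blast
qed

text \<open>
  The vector \<open>X *v c\<close> obtained here is the component of the \<open>i\<close>-th column orthogonal to the columns
  in \<open>A\<close>. Keeping its coefficients \<open>c\<close> lets one vector serve both as a null direction, when it
  vanishes, and as the normal of a hyperplane, when it does not.
\<close>

lemma column_orthogonal_component:
  fixes X :: "real^'p^'n"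
  assumes "i \<notin> A"
  shows "\<exists>c. c $ i = 1 \<and> (\<forall>j. j \<notin> insert i A \<longrightarrow> c $ j = 0)
           \<and> (\<forall>j\<in>A. column j X \<bullet> (X *v c) = 0)"
proof -
  let ?S = "(\<lambda>j. column j X) ` A"
  obtain u z where u: "u \<in> span ?S" and z: "\<And>w. w \<in> span ?S \<Longrightarrow> orthogonal z w"
    and sum: "column i X = u + z"
    using orthogonal_subspace_decomp_exists by blast
  obtain d where d: "\<And>j. j \<notin> A \<Longrightarrow> d $ j = 0" "X *v d = u"
    using span_columns_obtain_coefficients[OF u] by blast
  let ?c = "axis i 1 - d"
  have "X *v ?c = z"
    using sum d(2) by (simp add: matrix_vector_mult_diff_distrib matrix_vector_mult_basis)
  then have "column j X \<bullet> (X *v ?c) = 0" if "j \<in> A" for j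
    using z[of "column j X"] that by (simp add: span_base orthogonal_def inner_commute)
  moreover have "?c $ i = 1" "\<forall>j. j \<notin> insert i A \<longrightarrow> ?c $ j = 0"
    using d(1) assms by (auto simp: axis_def)
  ultimately show ?thesis by blast
qed

text \<open>
  The hyperplane must depend on \<open>y\<close> only through finitely many discrete choices. The set \<open>P\<close> of
  indices with positive correlation encodes the signs \<open>s\<^sub>j\<close>.
\<close>

lemma response_on_hyperplane:
  fixes X :: "real^'p^'n"
  defines "s \<equiv> \<lambda>P j. if j \<in> P then 1 else - 1 :: real"
  assumes equi: "\<And>j. c $ j \<noteq> 0 \<Longrightarrow> \<bar>column j X \<bullet> (y - X *v b)\<bar> = lam"
    and orth: "\<And>j. b $ j \<noteq> 0 \<Longrightarrow> column j X \<bullet> (X *v c) = 0"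
  shows "\<exists>P. (X *v c) \<bullet> y = lam * (\<Sum>j\<in>UNIV. c $ j * s P j)"
proof -
  let ?r = "y - X *v b"
  define P where "P = {j. 0 < column j X \<bullet> ?r}"
  have term_eq: "c $ j * (column j X \<bullet> ?r) = lam * (c $ j * s P j)" for j
  proof (cases "c $ j = 0")
    case False
    then show ?thesis using equi[OF False] by (auto simp: s_def P_def)
  qed simp
  have "(X *v b) \<bullet> (X *v c) = 0"
    unfolding matrix_vector_mult_inner_columns[of X b] using orth by (intro sum.neutral) auto
  then have "(X *v c) \<bullet> y = (X *v c) \<bullet> ?r"
    by (simp add: inner_diff_right inner_commute)
  also have "\<dots> = lam * (\<Sum>j\<in>UNIV. c $ j * s P j)"
    by (simp only: matrix_vector_mult_inner_columns term_eq sum_distrib_left)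
  finally show ?thesis by blast
qed

text \<open>
  This is strict complementarity at a generic response: unless \<open>y\<close> lies on one of the finitely many
  hyperplanes, a unique solution is nonzero on the whole equicorrelation set.
\<close>

lemma AE_unique_lasso_support_eq_equicorrelation:
  fixes X :: "real^'p^'n"
  assumes lam: "0 < lam"
  shows "AE y in lebesgue. \<forall>b. lasso_solution y X lam b \<longrightarrow>
           (\<forall>b'. lasso_solution y X lam b' \<longrightarrow> b' = b) \<longrightarrow>
           (\<forall>i. \<bar>column i X \<bullet> (y - X *v b)\<bar> = lam \<longrightarrow> b $ i \<noteq> 0)"
proof -
  define s :: "'p set \<Rightarrow> 'p \<Rightarrow> real" where "s P j = (if j \<in> P then 1 else - 1)" for P j
  define Q where "Q A i d \<longleftrightarrow> d $ i = 1 \<and> (\<forall>j. j \<notin> insert i A \<longrightarrow> d $ j = 0)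
      \<and> (\<forall>j\<in>A. column j X \<bullet> (X *v d) = 0)" for A i and d :: "real^'p"
  define c where "c A i = (SOME d. Q A i d)" for A i
  have "Q A i (c A i)" if "i \<notin> A" for A i
    unfolding c_def using column_orthogonal_component[OF that, of X]
    by (intro someI_ex[of "Q A i"]) (simp only: Q_def)
  then have c: "\<And>A i. i \<notin> A \<Longrightarrow> c A i $ i = 1"
      "\<And>A i j. i \<notin> A \<Longrightarrow> j \<notin> insert i A \<Longrightarrow> c A i $ j = 0"
      "\<And>A i j. i \<notin> A \<Longrightarrow> j \<in> A \<Longrightarrow> column j X \<bullet> (X *v c A i) = 0"
    by (simp_all only: Q_def) simp_all
  define H where "H = (\<lambda>(A, i, P). {y. X *v c A i \<noteq> 0 \<and>
      (X *v c A i) \<bullet> y = lam * (\<Sum>j\<in>UNIV. c A i $ j * s P j)})"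
  have "negligible (H k)" for k
  proof -
    obtain A i P where "k = (A, i, P)" by (metis prod.exhaust)
    then show ?thesis
      using negligible_hyperplane[of "X *v c A i"] by (cases "X *v c A i = 0") (auto simp: H_def)
  qed
  then have "negligible (\<Union>k. H k)"
    by (intro negligible_Union) auto
  then have "AE y in lebesgue. y \<notin> (\<Union>k. H k)"
    by (intro AE_not_in) (simp add: negligible_iff_null_sets)
  then show ?thesis
  proof (rule AE_mp, intro AE_I2 impI allI notI)
    fix y b i
    assume off: "y \<notin> (\<Union>k. H k)" and sol: "lasso_solution y X lam b"
      and unique: "\<forall>b'. lasso_solution y X lam b' \<longrightarrow> b' = b"
      and i: "\<bar>column i X \<bullet> (y - X *v b)\<bar> = lam" and bi: "b $ i = 0"
    let ?r = "y - X *v b"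
    define A where "A = {j. b $ j \<noteq> 0}"
    let ?c = "c A i"
    have iA: "i \<notin> A" using bi by (simp add: A_def)
    have equi: "\<bar>column j X \<bullet> ?r\<bar> = lam" if "?c $ j \<noteq> 0" for j
    proof (cases "j = i")
      case False
      then have "b $ j \<noteq> 0"
        using c(2)[OF iA, of j] that by (auto simp: A_def)
      then show ?thesis
        using column_inner_residual_on_support[OF sol] lam by (simp add: abs_mult)
    qed (use i in simp)
    show False
    proof (cases "X *v ?c = 0")
      case True
      \<comment> \<open>The scalar makes the entry at \<open>i\<close>, the only nonzero one off the support of \<open>b\<close>,
        have the sign of the correlation.\<close>
      let ?d = "(column i X \<bullet> ?r) *\<^sub>R ?c"
      have "?d = 0"
      proof (rule unique_lasso_null_direction_eq_0[OF lam sol])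
        show "X *v ?d = 0"
          using True by (simp add: matrix_vector_mult_scaleR)
        show "\<bar>column j X \<bullet> ?r\<bar> = lam" if "?d $ j \<noteq> 0" for j
          using equi that by simp
        show "0 \<le> ?d $ j * (column j X \<bullet> ?r)" if "b $ j = 0" for j
          using c(1,2)[OF iA] that by (cases "j = i") (auto simp: A_def)
      qed (use unique in blast)
      then show False
        using c(1)[OF iA] i lam by auto
    next
      case False
      obtain P where "(X *v ?c) \<bullet> y = lam * (\<Sum>j\<in>UNIV. ?c $ j * s P j)"
        using response_on_hyperplane[of ?c X y b lam, OF equi] c(3)[OF iA]
        by (auto simp: A_def s_def)
      with False have "y \<in> H (A, i, P)"
        by (simp add: H_def)
      with off show False by blast
    qed
  qed
qed

theorem lemma16:
  fixes X :: "real^'p^'n" and lam :: real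
  assumes "lam > 0"
  shows "AE y in lebesgue.
           (\<exists>!b. lasso_solution y X lam b) \<longrightarrow>
             null_submatrix X (equicorrelation_set y X lam) = {0}"
  using AE_unique_lasso_support_eq_equicorrelation[OF assms, of X]
proof (rule AE_mp, intro AE_I2 impI)
  fix y
  let ?E = "equicorrelation_set y X lam"
  assume full: "\<forall>b. lasso_solution y X lam b \<longrightarrow>
      (\<forall>b'. lasso_solution y X lam b' \<longrightarrow> b' = b) \<longrightarrow>
      (\<forall>i. \<bar>column i X \<bullet> (y - X *v b)\<bar> = lam \<longrightarrow> b $ i \<noteq> 0)"
    and "\<exists>!b. lasso_solution y X lam b"
  then obtain b where sol: "lasso_solution y X lam b"
    and unique: "\<And>b'. lasso_solution y X lam b' \<Longrightarrow> b' = b"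
    by blast
  have E: "?E = {i. \<bar>column i X \<bullet> (y - X *v b)\<bar> = lam}"
    using equicorrelation_set_eq[OF _ sol] assms by simp
  have "c = 0" if "c \<in> null_submatrix X ?E" for c
  proof (rule unique_lasso_null_direction_eq_0[OF assms sol unique])
    show "X *v c = 0"
      using that by (simp add: null_submatrix_iff)
    show equi: "\<bar>column i X \<bullet> (y - X *v b)\<bar> = lam" if "c $ i \<noteq> 0" for i
      using that \<open>c \<in> null_submatrix X ?E\<close> by (auto simp: null_submatrix_iff E)
    show "0 \<le> c $ i * (column i X \<bullet> (y - X *v b))" if "b $ i = 0" for i
    proof -
      have "c $ i = 0"
        using full sol unique equi that by blast
      then show ?thesis by simp
    qed
  qed
  moreover have "0 \<in> null_submatrix X ?E"
    by (simp add: null_submatrix_iff)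
  ultimately show "null_submatrix X ?E = {0}" by blast
qed

end
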